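(* Let the sequence $(b_n)_{n\ge0}$ be defined by $b_0=e^{\pi/2}$ and, for $n\ge0$, $$b_{n+1}=\frac{n}{n+1}b_n+\frac{\pi}{8(n+1)}\sum_{k=0}^{n}\frac{W_k^2}{k+1}b_{n-k}.$$ Then the sequence $\{b_n/W_n\}_{n\ge1}$ is increasing, and $$\lim_{n\to\infty}\frac{b_n}{W_n}=4.$$
   Context: $W_n=\frac{(2n-1)!!}{(2n)!!}=\frac{\Gamma(n+1/2)}{\Gamma(1/2)\Gamma(n+1)}$ for $n\ge0$ (so $W_0=1$). The $b_n$ are also the Maclaurin coefficients of $e^{\mathcal{K}(\sqrt{x})}=\sum_{n=0}^\infty b_nx^n$ on $(0,1)$, where $\mathcal{K}(r)=\int_0^{\pi/2}\frac{dt}{\sqrt{1-r^2\sin^2 t}}$ is the complete elliptic integral of the first kind, and the $W_n$ are those of $1/\sqrt{1-x}$. *)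

theory Defs
  imports "HOL-Analysis.Analysis"
begin

fun double_fact :: "nat \<Rightarrow> nat" where
  "double_fact 0 = 1"
| "double_fact (Suc 0) = 1"
| "double_fact (Suc (Suc n)) = Suc (Suc n) * double_fact n"

text \<open>For \<open>n = 0\<close> the truncated subtraction gives \<open>2 * n - 1 = 0\<close>, so the numerator is
  \<open>1\<close>, in agreement with the convention \<open>(-1)!! = 1\<close>.\<close>

definition W :: "nat \<Rightarrow> real" where
  "W n = real (double_fact (2 * n - 1)) / real (double_fact (2 * n))"

fun b :: "nat \<Rightarrow> real" where
  "b 0 = exp (pi / 2)"
| "b (Suc n) = real n / real (n + 1) * b n
     + pi / (8 * real (n + 1)) * (\<Sum>k\<le>n. (W k)\<^sup>2 / real (k + 1) * b (n - k))"

lemma W_0: "W 0 = 1"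
  by (simp add: W_def)

lemma W_Suc: "W (Suc n) = (2 * real n + 1) / (2 * real n + 2) * W n"
proof -
  have "double_fact (2 * Suc n - 1) = (2 * n + 1) * double_fact (2 * n - 1)"
    by (cases n) simp_all
  moreover have "double_fact (2 * Suc n) = (2 * n + 2) * double_fact (2 * n)"
    by simp
  ultimately show ?thesis
    unfolding W_def by (simp only: of_nat_mult times_divide_times_eq) (simp add: add.commute)
qed

lemma W_Gamma: "W n = Gamma (real n + 1 / 2) / (Gamma (1 / 2) * Gamma (real n + 1))"
proof (induction n)
  case 0
  show ?case by (simp add: W_0 Gamma_one_half_real)
next
  case (Suc n)
  have "real n + 1 / 2 \<notin> \<int>\<^sub>\<le>\<^sub>0" "real n + 1 \<notin> \<int>\<^sub>\<le>\<^sub>0"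
    by (auto dest!: nonpos_Ints_nonpos)
  then have "Gamma (real n + 1 / 2 + 1) = (real n + 1 / 2) * Gamma (real n + 1 / 2)"
      "Gamma (real n + 1 + 1) = (real n + 1) * Gamma (real n + 1)"
    by (blast intro: Gamma_plus1)+
  then have "Gamma (real (Suc n) + 1 / 2) = (real n + 1 / 2) * Gamma (real n + 1 / 2)"
      "Gamma (real (Suc n) + 1) = (real n + 1) * Gamma (real n + 1)"
    by (simp_all add: add_ac)
  moreover have "(2 * real n + 1) / (2 * real n + 2) = (real n + 1 / 2) / (real n + 1)"
    by (simp add: field_simps)
  ultimately show ?case
    by (simp only: W_Suc Suc.IH) (simp add: mult_ac)
qed

end

theory Submission
  imports Defs "HOL-Real_Asymp.Real_Asymp"
begin

text \<open>Write \<open>K(x)\<close> for the complete elliptic integral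
\<open>\<integral> dt / sqrt (1 - x sin\<^sup>2 t)\<close> over \<open>[0, \<pi>/2]\<close>, \<open>f = e\<^sup>K\<close> and
\<open>B(x) = 2 (1 - x) K'(x)\<close>. The coefficients \<open>\<beta>\<^sub>n\<close> of \<open>B\<close> are \<open>(\<pi>/4) W\<^sub>n\<^sup>2 / (n + 1)\<close>, so
the recurrence for \<open>b\<close> says exactly that \<open>2 (1 - x) F' = B F\<close> for the generating function \<open>F\<close> of
\<open>b\<close>; hence \<open>F = f\<close>.

Monotonicity. Clearing denominators, \<open>b\<^sub>n / W\<^sub>n < b\<^bsub>n+1\<^esub> / W\<^bsub>n+1\<^esub>\<close> means that the \<open>n\<close>-th
coefficient of \<open>(1 - B) F\<close> is negative. The product rule and the equation for \<open>F\<close> give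
\<open>2 ((1 - B) F)' = - F G / (1 - x)\<close> with \<open>G = 2 (1 - x) B' - B (1 - B)\<close>. Since \<open>F\<close> has positive
coefficients, it is enough that those of \<open>G / (1 - x)\<close>, the partial sums of the coefficients of
\<open>G\<close>, are positive (\<open>gap_pos\<close>). They tend to \<open>G(1) = 0\<close>, because Wallis' product yields
\<open>B(1) = 1\<close>. The first one is positive because \<open>\<pi> > 3\<close>. From index 1 on they decrease: this
amounts to the upper bound \<open>ellB2_upper\<close> for the coefficients of \<open>B\<^sup>2\<close>, which is proved by
induction. So all of them lie above their limit 0.

Limit. Splitting off \<open>\<integral> r sin t / sqrt (1 - r\<^sup>2 sin\<^sup>2 t) dt = arsinh (r / sqrt (1 - r\<^sup>2))\<close> from
\<open>K(r\<^sup>2)\<close> leaves an integral that is continuous up to \<open>r = 1\<close> with value \<open>ln 2\<close> there. Therefore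
\<open>sqrt (1 - x) f(x)\<close> tends to 4 as \<open>x\<close> increases to 1. As \<open>1 / sqrt (1 - x)\<close> generates \<open>W\<close> and
diverges at 1, and as \<open>b\<^sub>n / W\<^sub>n\<close> is monotone, comparing power series on both sides shows that
\<open>b\<^sub>n / W\<^sub>n\<close> is bounded by 4 and that its limit is not below 4.\<close>

section \<open>Wallis' product and the coefficients of B\<close>

lemma W_pos: "W n > 0"
  by (induction n) (simp_all add: W_0 W_Suc)

lemma wallis_prod_eq_W:
  "(\<Prod>k=1..n. (4 * real k ^ 2) / (4 * real k ^ 2 - 1)) = 1 / ((2 * real n + 1) * (W n)\<^sup>2)"
proof (induction n)
  case (Suc n)
  have "4 * (real n + 1)\<^sup>2 - 1 = (2 * real n + 1) * (2 * real n + 3)"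
    by (simp add: power2_eq_square algebra_simps)
  then have "(\<Prod>k=1..Suc n. (4 * real k ^ 2) / (4 * real k ^ 2 - 1))
      = 1 / ((2 * real n + 1) * (W n)\<^sup>2)
        * (4 * (real n + 1)\<^sup>2 / ((2 * real n + 1) * (2 * real n + 3)))"
    by (simp only: prod.nat_ivl_Suc' Suc.IH) (simp add: add.commute)
  also have "\<dots> = 1 / ((2 * real (Suc n) + 1) * (W (Suc n))\<^sup>2)"
    using W_pos[of n] unfolding W_Suc
    by (simp add: divide_simps power2_eq_square) (simp add: algebra_simps)
  finally show ?case .
qed (simp add: W_0)

lemma W_sq_asymp: "(\<lambda>n. (2 * real n + 1) * (W n)\<^sup>2) \<longlonglongrightarrow> 2 / pi"
  using tendsto_inverse[OF wallis] unfolding wallis_prod_eq_W by simp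

text \<open>The Maclaurin coefficients \<open>\<beta>\<^sub>n\<close> of the elliptic integral
\<open>B(x) = \<integral> cos\<^sup>2 t / sqrt (1 - x sin\<^sup>2 t) dt\<close> over \<open>[0, \<pi>/2]\<close>, which equals \<open>2 (1 - x) K'(x)\<close>.\<close>

definition ellB :: "nat \<Rightarrow> real" where
  "ellB n = pi / 4 * (W n)\<^sup>2 / (real n + 1)"

lemma ellB_pos: "ellB n > 0"
  using W_pos[of n] by (simp add: ellB_def)

lemma ellB_0: "ellB 0 = pi / 4"
  by (simp add: ellB_def W_0)

lemma ellB_Suc: "ellB (Suc n) = (real n + 1 / 2)\<^sup>2 / ((real n + 1) * (real n + 2)) * ellB n"
  unfolding ellB_def W_Suc by (simp add: divide_simps power2_eq_square) (simp add: algebra_simps)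

text \<open>This is the coefficient form of \<open>B = 2 (1 - x) K'\<close>; it makes the partial sums of \<open>\<beta>\<close> explicit.\<close>

lemma ellB_telescope: "ellB n = pi * (real n + 1) * (W (Suc n))\<^sup>2 - pi * real n * (W n)\<^sup>2"
  unfolding ellB_def W_Suc by (simp add: divide_simps power2_eq_square) (simp add: algebra_simps)

lemma sum_ellB: "(\<Sum>k<n. ellB k) = pi * real n * (W n)\<^sup>2"
  by (induction n) (simp_all add: ellB_telescope add.commute)

lemma ellB_sums_1: "ellB sums 1"
proof -
  have "(\<lambda>n. 1 / (2 * real n + 1)) \<longlonglongrightarrow> 0"
    by real_asymp
  from tendsto_mult[OF tendsto_mult[OF tendsto_const[of "pi / 2"] W_sq_asymp]
      tendsto_diff[OF tendsto_const[of 1] this]]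
  have "(\<lambda>n. pi / 2 * ((2 * real n + 1) * (W n)\<^sup>2) * (1 - 1 / (2 * real n + 1))) \<longlonglongrightarrow> 1"
    by simp
  moreover have "pi / 2 * ((2 * real n + 1) * (W n)\<^sup>2) * (1 - 1 / (2 * real n + 1))
      = pi * real n * (W n)\<^sup>2" for n
  proof -
    have "1 - 1 / (2 * real n + 1) = 2 * real n / (2 * real n + 1)"
      by (simp add: field_simps)
    then show ?thesis by simp
  qed
  ultimately show ?thesis
    unfolding sums_def sum_ellB by (simp only:)
qed

text \<open>By Wallis' product \<open>\<beta>\<^sub>n\<close> has the order of \<open>1 / n\<^sup>2\<close>.\<close>

lemma n_ellB_tendsto_0: "(\<lambda>n. real n * ellB n) \<longlonglongrightarrow> 0"
proof -
  have "(\<lambda>n. real n / ((2 * real n + 1) * (real n + 1))) \<longlonglongrightarrow> 0"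
    by real_asymp
  from tendsto_mult[OF tendsto_mult[OF tendsto_const[of "pi / 4"] W_sq_asymp] this]
  have "(\<lambda>n. pi / 4 * ((2 * real n + 1) * (W n)\<^sup>2) * (real n / ((2 * real n + 1) * (real n + 1)))) \<longlonglongrightarrow> 0"
    by simp
  then show ?thesis
    by (simp add: ellB_def mult_ac)
qed

section \<open>The coefficients of the square of B\<close>

definition ellB2 :: "nat \<Rightarrow> real" where
  "ellB2 n = (\<Sum>k\<le>n. ellB k * ellB (n - k))"

lemma sum_atMost_reverse: "(\<Sum>k\<le>n. f (n - k)) = (\<Sum>k\<le>(n::nat). f k)" for f :: "nat \<Rightarrow> real"
  using sum.nat_diff_reindex[of f "Suc n"] by (simp add: lessThan_Suc_atMost)

text \<open>Differentiating \<open>B\<^sup>2\<close> replaces the weight \<open>n + 1\<close> in the convolution by \<open>2 (k + 1)\<close> on one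
factor. The two-term recurrence of \<open>\<beta>\<close> turns this into the weight
\<open>2 (k - 1) + (9/2) / (k + 2)\<close> on the convolution of index \<open>n\<close>, and symmetrizing in \<open>k\<close> and
\<open>n - k\<close> makes its linear part the constant \<open>n - 2\<close>.\<close>

lemma ellB2_Suc:
  "(real n + 1) * ellB2 (Suc n) = (real n - 2) * ellB2 n
     + 9 / 4 * (\<Sum>k\<le>n. ellB k * ellB (n - k) * (1 / (real k + 2) + 1 / (real (n - k) + 2)))"
proof -
  let ?s = "\<lambda>k. ellB k * ellB (n - k)"
  have sym: "(\<Sum>k\<le>m. h k (m - k)) = (\<Sum>k\<le>m. (h k (m - k) + h (m - k) k) / 2)"
    for h :: "nat \<Rightarrow> nat \<Rightarrow> real" and m
  proof -
    have "(\<Sum>k\<le>m. h (m - k) k) = (\<Sum>k\<le>m. h k (m - k))"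
      using sum_atMost_reverse[of "\<lambda>k. h k (m - k)" m] by simp
    then show ?thesis
      by (simp add: sum_divide_distrib[symmetric] sum.distrib)
  qed
  have step: "(real k + 1) * ellB (Suc k) = (real k - 1 + 9 / 4 * (1 / (real k + 2))) * ellB k" for k
    unfolding ellB_Suc by (simp add: divide_simps power2_eq_square) (simp add: algebra_simps)
  have "(real n + 1) * ellB2 (Suc n)
      = (\<Sum>k\<le>Suc n. 2 * (real k * ellB k * ellB (Suc n - k)))"
    unfolding ellB2_def sum_distrib_left
    by (subst sym[of "\<lambda>k j. 2 * (real k * ellB k * ellB j)" "Suc n"])
       (intro sum.cong refl, auto simp: of_nat_diff algebra_simps)
  also have "\<dots> = (\<Sum>k\<le>n. 2 * ((real k + 1) * ellB (Suc k) * ellB (n - k)))"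
    by (subst sum.atMost_Suc_shift) (simp add: add.commute)
  also have "\<dots> = (\<Sum>k\<le>n. 2 * (real k - 1 + 9 / 4 * (1 / (real k + 2))) * ?s k)"
    unfolding step by (intro sum.cong refl) (simp only: mult_ac)
  also have "\<dots> = (\<Sum>k\<le>n. (real n - 2) * ?s k
      + 9 / 4 * (?s k * (1 / (real k + 2) + 1 / (real (n - k) + 2))))"
  proof (subst sym[of "\<lambda>k j. 2 * (real k - 1 + 9 / 4 * (1 / (real k + 2))) * (ellB k * ellB j)" n],
      intro sum.cong refl)
    fix k assume "k \<in> {..n}"
    have "(2 * (p - 1 + 9 / 4 * u) * (y * z) + 2 * (q - 1 + 9 / 4 * v) * (z * y)) / 2
        = (p + q - 2) * (y * z) + 9 / 4 * (y * z * (u + v))" for p q u v y z :: real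
      by (simp add: field_simps)
    note this[of "real k" "1 / (real k + 2)" "ellB k" "ellB (n - k)" "real (n - k)"
        "1 / (real (n - k) + 2)"]
    moreover have "real k + real (n - k) = real n"
      using \<open>k \<in> {..n}\<close> by simp
    ultimately show "(2 * (real k - 1 + 9 / 4 * (1 / (real k + 2))) * ?s k
        + 2 * (real (n - k) - 1 + 9 / 4 * (1 / (real (n - k) + 2))) * (ellB (n - k) * ellB k)) / 2
      = (real n - 2) * ?s k + 9 / 4 * (?s k * (1 / (real k + 2) + 1 / (real (n - k) + 2)))"
      by (simp only:)
  qed
  finally show ?thesis
    by (simp add: ellB2_def sum.distrib sum_distrib_left)
qed

text \<open>The weight \<open>1 / (k + 2) + 1 / (n - k + 2)\<close> is convex in \<open>k\<close>, so on \<open>1 \<le> k \<le> n - 1\<close> it is at most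
its value \<open>1/3 + 1/(n + 1)\<close> at \<open>k = 1\<close>. The larger weight at the two ends is kept apart, on their
contribution \<open>2 \<beta>\<^sub>0 \<beta>\<^sub>n\<close> to the convolution: bounding all terms by this larger weight would lose
too much for the induction that proves \<open>ellB2_upper\<close>.\<close>

lemma ellB2_Suc_le:
  assumes "n \<ge> 2"
  shows "(real n + 1) * ellB2 (Suc n)
     \<le> (real n - 2 + 9 / 4 * (1 / 3 + 1 / (real n + 1))) * ellB2 n
       + 9 / 2 * (1 / 6 + 1 / (real n + 2) - 1 / (real n + 1)) * ellB 0 * ellB n"
proof -
  obtain m where m: "n = Suc m" using assms by (cases n) auto
  let ?s = "\<lambda>k. ellB k * ellB (n - k)"
  let ?w = "\<lambda>k. 1 / (real k + 2) + 1 / (real (n - k) + 2)"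
  let ?M = "1 / 3 + 1 / (real n + 1)"
  let ?e = "1 / 6 + 1 / (real n + 2) - 1 / (real n + 1)"
  have interior: "?w k \<le> ?M" if "1 \<le> k" "k < n" for k
  proof -
    have "(real n + 4) * (3 * (real n + 1)) \<le> (real n + 4) * ((real k + 2) * (real (n - k) + 2))"
    proof (rule mult_left_mono)
      have "0 \<le> (real k - 1) * (real n - real k - 1)"
        using that by (intro mult_nonneg_nonneg) auto
      then show "3 * (real n + 1) \<le> (real k + 2) * (real (n - k) + 2)"
        using that by (simp add: of_nat_diff algebra_simps)
    qed simp
    moreover have "?w k = (real n + 4) / ((real k + 2) * (real (n - k) + 2))"
      "?M = (real n + 4) / (3 * (real n + 1))"
      using that by (simp_all add: field_simps of_nat_diff)
    ultimately show ?thesis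
      by (simp only:) (intro divide_left_mono, auto)
  qed
  have "(\<Sum>k\<le>n. ?s k * ?w k) \<le> (\<Sum>k\<le>n. ?M * ?s k + (if k = 0 \<or> k = n then ?e * ellB 0 * ellB n else 0))"
  proof (rule sum_mono)
    fix k assume "k \<in> {..n}"
    show "?s k * ?w k \<le> ?M * ?s k + (if k = 0 \<or> k = n then ?e * ellB 0 * ellB n else 0)"
    proof (cases "k = 0 \<or> k = n")
      case True
      then show ?thesis by (auto simp: algebra_simps)
    next
      case False
      then have "?w k \<le> ?M" using \<open>k \<in> {..n}\<close> by (intro interior) auto
      then have "?s k * ?w k \<le> ?s k * ?M"
        by (intro mult_left_mono) (auto simp: ellB_pos less_imp_le)
      then show ?thesis using False by (simp add: mult.commute)
    qed
  qed
  also have "\<dots> = ?M * ellB2 n + 2 * ?e * ellB 0 * ellB n"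
  proof -
    have "(\<Sum>k\<le>n. if k = 0 \<or> k = n then r else 0) = 2 * r" for r :: real
      unfolding m by (subst sum.atMost_Suc, subst sum.atMost_shift) (simp add: sum.neutral)
    then show ?thesis
      by (simp add: sum.distrib ellB2_def flip: sum_distrib_left)
  qed
  finally have "(\<Sum>k\<le>n. ?s k * ?w k) \<le> ?M * ellB2 n + 2 * ?e * ellB 0 * ellB n" .
  then have "9 / 4 * (\<Sum>k\<le>n. ?s k * ?w k) \<le> 9 / 4 * (?M * ellB2 n + 2 * ?e * ellB 0 * ellB n)"
    by (intro mult_left_mono) auto
  with ellB2_Suc[of n] show ?thesis
    by (simp add: algebra_simps)
qed

text \<open>As \<open>n\<close> grows, the left side is asymptotic to \<open>2 \<beta>\<^sub>n\<close> (the total mass of \<open>\<beta>\<close> is 1) and the right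
side to \<open>3 \<beta>\<^sub>n\<close>, so there is room, but the inequality is tight for small \<open>n\<close>. The base case
is equivalent to \<open>\<beta>\<^sub>0 < 45/56\<close>, that is \<open>\<pi> < 45/14\<close>, and the same bound on \<open>\<beta>\<^sub>0\<close> suffices for
the induction step.\<close>

lemma ellB2_upper:
  "ellB2 (n + 2) < 3 * (2 * real (n + 2) + 1) / (2 * real (n + 2) + 4) * ellB (n + 2)"
proof (induction n)
  case 0
  have 1: "ellB (Suc 0) = ellB 0 / 8" "ellB 2 = 3 * ellB 0 / 64"
    by (simp_all add: ellB_Suc numeral_2_eq_2 power2_eq_square)
  have "{..2} = {0, 1, 2::nat}" by auto
  then have "ellB2 2 = 7 / 64 * ellB 0 * ellB 0"
    by (simp add: ellB2_def 1)
  also have "\<dots> < 7 / 64 * (45 / 56) * ellB 0"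
    using ellB_pos[of 0] pi_approx by (intro mult_strict_right_mono) (auto simp: ellB_0)
  finally show ?case
    by (simp add: 1 add_2_eq_Suc' flip: numeral_2_eq_2)
next
  case (Suc m)
  define n where "n = m + 2"
  have n: "n \<ge> 2" by (simp add: n_def)
  define x where "x = real m"
  have x: "x \<ge> 0" "real n = x + 2" by (auto simp: x_def n_def)
  let ?l = "3 * (2 * real n + 1) / (2 * real n + 4)"
  let ?l' = "3 * (2 * real n + 3) / (2 * real n + 6)"
  have "(real n + 1) * ellB2 (Suc n)
     \<le> (real n - 2 + 9 / 4 * (1 / 3 + 1 / (real n + 1))) * ellB2 n
       + 9 / 2 * (1 / 6 + 1 / (real n + 2) - 1 / (real n + 1)) * ellB 0 * ellB n"
    by (rule ellB2_Suc_le[OF n])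
  also have "\<dots> \<le> (real n - 2 + 9 / 4 * (1 / 3 + 1 / (real n + 1))) * (?l * ellB n)
       + 9 / 2 * (1 / 6 + 1 / (real n + 2) - 1 / (real n + 1)) * (45 / 56) * ellB n"
  proof (intro add_mono mult_left_mono mult_right_mono)
    show "ellB2 n \<le> ?l * ellB n" using Suc by (simp add: n_def)
    show "ellB 0 \<le> 45 / 56" using pi_approx by (simp add: ellB_0)
    show "0 \<le> 9 / 2 * (1 / 6 + 1 / (real n + 2) - 1 / (real n + 1))"
      using x by (simp add: divide_simps) (simp add: algebra_simps)
  qed (use n in \<open>auto simp: ellB_pos less_imp_le\<close>)
  also have "\<dots> = ((real n - 2 + 9 / 4 * (1 / 3 + 1 / (real n + 1))) * ?l
       + 9 / 2 * (1 / 6 + 1 / (real n + 2) - 1 / (real n + 1)) * (45 / 56)) * ellB n"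
    by (simp add: algebra_simps)
  also have "\<dots> < (?l' * (real n + 1 / 2)\<^sup>2 / (real n + 2)) * ellB n"
  proof (rule mult_strict_right_mono)
    show "(real n - 2 + 9 / 4 * (1 / 3 + 1 / (real n + 1))) * ?l
       + 9 / 2 * (1 / 6 + 1 / (real n + 2) - 1 / (real n + 1)) * (45 / 56)
       < ?l' * (real n + 1 / 2)\<^sup>2 / (real n + 2)"
    proof -
      \<comment> \<open>In terms of \<open>x = n - 2\<close> the difference has only positive coefficients.\<close>
      have "?l' * (real n + 1 / 2)\<^sup>2 / (real n + 2)
        - ((real n - 2 + 9 / 4 * (1 / 3 + 1 / (real n + 1))) * ?l
           + 9 / 2 * (1 / 6 + 1 / (real n + 2) - 1 / (real n + 1)) * (45 / 56))
        = (2250 + 2865 * x + 1152 * x ^ 2 + 33 * x ^ 3) / (224 * (x + 3) * (x + 4) * (x + 5))"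
        using x(1) unfolding x(2)
        by (simp add: divide_simps power2_eq_square power3_eq_cube) (simp add: algebra_simps)
      also have "\<dots> > 0"
        using x(1) by (intro divide_pos_pos) (auto intro!: add_pos_nonneg)
      finally show ?thesis by simp
    qed
  qed (rule ellB_pos)
  also have "\<dots> = (real n + 1) * (?l' * ellB (Suc n))"
    unfolding ellB_Suc by (simp add: divide_simps) (simp add: algebra_simps)
  finally have "ellB2 (Suc n) < ?l' * ellB (Suc n)"
    by (subst (asm) mult_less_cancel_left_pos) auto
  then show ?case
    by (simp add: n_def algebra_simps)
qed

section \<open>Monotonicity of the quotients\<close>

text \<open>The coefficients of \<open>G / (1 - x)\<close> with \<open>G = 2 (1 - x) B' - B (1 - B)\<close>, equivalently of
\<open>2 B' - B (1 - B) / (1 - x)\<close>: division by \<open>1 - x\<close> forms partial sums.\<close>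

definition gap :: "nat \<Rightarrow> real" where
  "gap n = 2 * (real n + 1) * ellB (Suc n) - (\<Sum>k\<le>n. ellB k) + (\<Sum>k\<le>n. ellB2 k)"

lemma gap_Suc:
  "gap (Suc n) = gap n + ellB2 (Suc n)
     - 3 * (2 * real (Suc n) + 1) / (2 * real (Suc n) + 4) * ellB (Suc n)"
  unfolding gap_def ellB_Suc[of "Suc n"]
  by (simp add: divide_simps power2_eq_square) (simp add: algebra_simps)

lemma ellB2_sums_1: "ellB2 sums 1"
proof -
  have "summable (\<lambda>k. norm (ellB k))"
    using ellB_sums_1 by (simp add: ellB_pos less_imp_le sums_iff)
  from Cauchy_product_sums[OF this this] show ?thesis
    using ellB_sums_1 by (simp add: ellB2_def[abs_def] sums_iff)
qed

text \<open>\<open>B\<close> and \<open>B\<^sup>2\<close> both have the value 1 at \<open>x = 1\<close>, so the two partial sums cancel in the limit.\<close>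

lemma gap_tendsto_0: "gap \<longlonglongrightarrow> 0"
proof -
  have "(\<lambda>n. 2 * (real (Suc n) * ellB (Suc n)) - (\<Sum>k\<le>n. ellB k) + (\<Sum>k\<le>n. ellB2 k)) \<longlonglongrightarrow> 2 * 0 - 1 + 1"
    using ellB_sums_1 ellB2_sums_1
    by (intro tendsto_intros LIMSEQ_Suc[OF n_ellB_tendsto_0]) (simp_all add: sums_def_le)
  then show ?thesis
    by (simp add: gap_def[abs_def] algebra_simps)
qed

text \<open>The sequence is strictly decreasing from index 1 on and tends to 0, hence positive there. The
step from index 0 to index 1 is an increase, so index 0 is computed: its sign is that of
\<open>\<pi>/4 - 3/4\<close>.\<close>

lemma gap_pos: "gap n > 0"
proof (cases n)
  case 0
  have "gap 0 = ellB 0 * (ellB 0 - 3 / 4)"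
    by (simp add: gap_def ellB2_def ellB_Suc power2_eq_square algebra_simps)
  also have "\<dots> > 0"
    using pi_gt3 by (simp add: ellB_0)
  finally show ?thesis by (simp add: 0)
next
  case (Suc m)
  have less: "gap (Suc (Suc i)) < gap (Suc i)" for i
    using ellB2_upper[of i] by (simp add: gap_Suc[of "Suc i"])
  have "decseq (\<lambda>i. gap (Suc i))"
    by (intro decseq_SucI less_imp_le less)
  then have "0 \<le> gap (Suc (Suc m))"
    by (rule decseq_ge) (rule LIMSEQ_Suc[OF gap_tendsto_0])
  with less[of m] show ?thesis by (simp add: Suc)
qed

text \<open>The given recurrence in the form \<open>2 (1 - x) F' = B F\<close>, coefficient by coefficient.\<close>

lemma b_Suc: "2 * (real n + 1) * b (Suc n) = 2 * real n * b n + (\<Sum>k\<le>n. ellB k * b (n - k))"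
proof -
  have split: "2 * (y + 1) * (y / (y + 1) * u + pi / (8 * (y + 1)) * v) = 2 * y * u + pi / 4 * v"
    if "y \<ge> 0" for y u v :: real
  proof -
    have "2 * (y + 1) * (y / (y + 1) * u) = 2 * y * u"
      "2 * (y + 1) * (pi / (8 * (y + 1)) * v) = pi / 4 * v"
      using that by (simp_all add: divide_simps)
    then show ?thesis by (simp only: distrib_left)
  qed
  have "pi / 4 * (\<Sum>k\<le>n. (W k)\<^sup>2 / real (k + 1) * b (n - k)) = (\<Sum>k\<le>n. ellB k * b (n - k))"
    unfolding sum_distrib_left by (intro sum.cong refl) (simp add: ellB_def add.commute)
  then show ?thesis
    by (simp only: b.simps of_nat_add of_nat_1 split of_nat_0_le_iff)
qed

lemma b_pos: "b n > 0"
proof (induction n rule: less_induct)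
  case (less n)
  show ?case
  proof (cases n)
    case (Suc m)
    have "(\<Sum>k\<le>m. ellB k * b (m - k)) > 0"
      using less.IH Suc by (intro sum_pos mult_pos_pos ellB_pos) auto
    moreover have "real m * b m \<ge> 0"
      using less.IH[of m] Suc by simp
    ultimately have "0 < 2 * (real m + 1) * b (Suc m)"
      unfolding b_Suc by simp
    then show ?thesis
      by (simp add: Suc zero_less_mult_iff del: b.simps)
  qed simp
qed

lemma fps_ode_b:
  "2 * (1 - fps_X) * fps_deriv (Abs_fps b) = Abs_fps ellB * Abs_fps b"
proof (rule fps_ext)
  fix n
  have "fps_nth (2 * (1 - fps_X) * fps_deriv (Abs_fps b)) n
      = 2 * (real n + 1) * b (Suc n) - 2 * real n * b n"
    by (cases n) (simp_all add: algebra_simps numeral_fps_const del: b.simps)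
  also have "\<dots> = fps_nth (Abs_fps ellB * Abs_fps b) n"
    unfolding b_Suc by (simp add: fps_mult_nth atLeast0AtMost)
  finally show "fps_nth (2 * (1 - fps_X) * fps_deriv (Abs_fps b)) n
    = fps_nth (Abs_fps ellB * Abs_fps b) n" .
qed

lemma fps_gap:
  "(1 - fps_X) * Abs_fps gap
     = 2 * (1 - fps_X) * fps_deriv (Abs_fps ellB) - Abs_fps ellB * (1 - Abs_fps ellB)"
proof (rule fps_ext)
  fix n
  have sq: "fps_nth (Abs_fps ellB * Abs_fps ellB) n = ellB2 n" for n
    by (simp add: fps_mult_nth atLeast0AtMost ellB2_def)
  have "fps_nth ((1 - fps_X) * Abs_fps gap) n = gap n - (if n = 0 then 0 else gap (n - 1))"
    by (simp add: algebra_simps)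
  also have "\<dots> = 2 * ((real n + 1) * ellB (Suc n) - real n * ellB n) - ellB n + ellB2 n"
    by (cases n) (simp_all add: gap_def algebra_simps)
  also have "\<dots> = fps_nth (2 * (1 - fps_X) * fps_deriv (Abs_fps ellB) - Abs_fps ellB * (1 - Abs_fps ellB)) n"
    by (cases n) (simp_all add: algebra_simps numeral_fps_const sq del: fps_mult_nth_0 fps_mult_nth_1')
  finally show "fps_nth ((1 - fps_X) * Abs_fps gap) n
    = fps_nth (2 * (1 - fps_X) * fps_deriv (Abs_fps ellB) - Abs_fps ellB * (1 - Abs_fps ellB)) n" .
qed

text \<open>The coefficients of \<open>P = (1 - B) F\<close> are computed from its derivative: the equations for \<open>F'\<close> and
\<open>gap\<close> give \<open>2 (1 - x) P' = - (1 - x) (G / (1 - x)) F\<close>, where \<open>1 - x\<close> cancels and what remains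
has negative coefficients. The constant term of \<open>P\<close> does not enter \<open>P'\<close>, and it is positive,
which is why index 0 is excluded.\<close>

lemma b_less_conv:
  assumes "n \<ge> 1"
  shows "b n < (\<Sum>k\<le>n. ellB k * b (n - k))"
proof -
  obtain m where m: "n = Suc m" using assms by (cases n) auto
  let ?F = "Abs_fps b" and ?C = "Abs_fps ellB" and ?X = "fps_X :: real fps"
  define P where "P = (1 - ?C) * ?F"
  have "(1 - ?X) * (2 * fps_deriv P)
      = (1 - ?C) * (2 * (1 - ?X) * fps_deriv ?F) - 2 * (1 - ?X) * fps_deriv ?C * ?F"
    unfolding P_def by (simp add: algebra_simps)
  also have "\<dots> = - (2 * (1 - ?X) * fps_deriv ?C - ?C * (1 - ?C)) * ?F"
    unfolding fps_ode_b by (simp add: algebra_simps)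
  also have "\<dots> = (1 - ?X) * (- (Abs_fps gap * ?F))"
    unfolding fps_gap[symmetric] by (simp add: algebra_simps)
  finally have "2 * fps_deriv P = - (Abs_fps gap * ?F)"
  proof (subst (asm) mult_cancel_left, elim disjE)
    assume "1 - ?X = 0"
    then have "fps_nth (1 - ?X) 0 = 0" by simp
    then show ?thesis by simp
  qed
  from arg_cong[OF this, of "\<lambda>f. fps_nth f m"]
  have "2 * ((real m + 1) * fps_nth P (Suc m)) = - fps_nth (Abs_fps gap * ?F) m"
    by (simp add: numeral_fps_const add.commute)
  also have "\<dots> = - (\<Sum>k\<le>m. gap k * b (m - k))"
    by (simp add: fps_mult_nth atLeast0AtMost)
  also have "\<dots> < 0"
    by (simp add: sum_pos gap_pos b_pos)
  finally have "fps_nth P n < 0"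
    by (simp add: m mult_less_0_iff)
  moreover have "fps_nth P n = b n - (\<Sum>k\<le>n. ellB k * b (n - k))"
    by (simp add: P_def left_diff_distrib fps_mult_nth atLeast0AtMost)
  ultimately show ?thesis by simp
qed

lemma b_W_ratio_Suc:
  assumes "n \<ge> 1"
  shows "b n / W n < b (Suc n) / W (Suc n)"
proof -
  have "(2 * real n + 1) * b n < 2 * (real n + 1) * b (Suc n)"
    using b_less_conv[OF assms] unfolding b_Suc by (simp add: algebra_simps)
  then have "(2 * real n + 1) * b n / ((2 * real n + 1) * W n)
      < 2 * (real n + 1) * b (Suc n) / ((2 * real n + 1) * W n)"
    using W_pos[of n] by (intro divide_strict_right_mono) auto
  moreover have "2 * (real n + 1) * b (Suc n) / ((2 * real n + 1) * W n) = b (Suc n) / W (Suc n)"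
    unfolding W_Suc by (simp add: mult.commute del: b.simps)
  ultimately show ?thesis by simp
qed

lemma b_W_ratio_strict_mono: "strict_mono_on {1..} (\<lambda>n. b n / W n)"
proof (rule strict_mono_onI)
  fix m n :: nat
  assume mn: "m \<in> {1..}" "n \<in> {1..}" "m < n"
  have "strict_mono (\<lambda>i. b (Suc i) / W (Suc i))"
    unfolding strict_mono_Suc_iff by (intro allI b_W_ratio_Suc) simp
  from strict_monoD[OF this, of "m - 1" "n - 1"] mn
  show "b m / W m < b n / W n"
    by (simp del: b.simps)
qed

section \<open>The complete elliptic integral near its singularity\<close>

lemma inverse_sqrt_sums:
  fixes y :: real
  assumes "\<bar>y\<bar> < 1"
  shows "(\<lambda>n. W n * y ^ n) sums (1 / sqrt (1 - y))"
proof -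
  have eq: "((- 1 / 2) gchoose n) * (- y) ^ n = W n * y ^ n" for n
  proof (induction n)
    case (Suc n)
    have "((- 1 / 2 :: real) gchoose Suc n) = - ((2 * real n + 1) / (2 * real n + 2)) * ((- 1 / 2) gchoose n)"
      using gbinomial_mult_1[of "- 1 / 2 :: real" n] by (simp add: field_simps)
    then have "((- 1 / 2) gchoose Suc n) * (- y) ^ Suc n
        = (2 * real n + 1) / (2 * real n + 2) * y * (((- 1 / 2) gchoose n) * (- y) ^ n)"
      by simp
    also have "\<dots> = W (Suc n) * y ^ Suc n"
      unfolding Suc.IH W_Suc by simp
    finally show ?case .
  qed (simp add: W_0)
  have "(\<lambda>n. ((- 1 / 2) gchoose n) * (- y) ^ n) sums (1 + (- y)) powr (- 1 / 2)"
    using assms by (intro gen_binomial_real) simp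
  moreover have "(1 + (- y)) powr (- 1 / 2) = 1 / sqrt (1 - y)"
    using assms by (simp add: powr_minus_divide powr_half_sqrt)
  ultimately show ?thesis by (simp only: eq)
qed

lemma integral_sin_power_even:
  "((\<lambda>t. sin t ^ (2 * n)) has_integral (pi / 2 * W n)) {0..pi / 2}"
proof (induction n)
  case 0
  show ?case using has_integral_const_real[of "1 :: real" 0 "pi / 2"] by (simp add: W_0)
next
  case (Suc n)
  have "((\<lambda>t. (2 * real n + 1) * sin t ^ (2 * n) - (2 * real n + 2) * sin t ^ (2 * Suc n))
      has_integral (sin (pi / 2) ^ (2 * n + 1) * cos (pi / 2) - sin 0 ^ (2 * n + 1) * cos 0)) {0..pi / 2}"
  proof (rule fundamental_theorem_of_calculus)
    fix t :: real
    have "((\<lambda>t. sin t ^ (2 * n + 1) * cos t) has_real_derivative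
        real (2 * n + 1) * sin t ^ (2 * n) * cos t * cos t - sin t ^ (2 * n + 1) * sin t)
        (at t within {0..pi / 2})"
      by (rule derivative_eq_intros refl)+ simp
    also have "real (2 * n + 1) * sin t ^ (2 * n) * cos t * cos t - sin t ^ (2 * n + 1) * sin t
        = (2 * real n + 1) * sin t ^ (2 * n) - (2 * real n + 2) * sin t ^ (2 * Suc n)"
    proof -
      have "real (2 * n + 1) * sin t ^ (2 * n) * cos t * cos t - sin t ^ (2 * n + 1) * sin t
          = sin t ^ (2 * n) * ((2 * real n + 1) * (cos t)\<^sup>2 - (sin t)\<^sup>2)"
        by (simp add: power2_eq_square algebra_simps)
      also have "\<dots> = sin t ^ (2 * n) * ((2 * real n + 1) - (2 * real n + 2) * (sin t)\<^sup>2)"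
        unfolding cos_squared_eq by (simp add: algebra_simps)
      finally show ?thesis
        by (simp add: power2_eq_square algebra_simps)
    qed
    finally show "((\<lambda>t. sin t ^ (2 * n + 1) * cos t) has_vector_derivative
        (2 * real n + 1) * sin t ^ (2 * n) - (2 * real n + 2) * sin t ^ (2 * Suc n))
        (at t within {0..pi / 2})"
      by (simp add: has_real_derivative_iff_has_vector_derivative)
  qed simp
  then have "((\<lambda>t. (2 * real n + 1) * sin t ^ (2 * n) - (2 * real n + 2) * sin t ^ (2 * Suc n))
      has_integral 0) {0..pi / 2}"
    by simp
  from has_integral_diff[OF has_integral_mult_right[OF Suc.IH, of "2 * real n + 1"] this]
  have "((\<lambda>t. (2 * real n + 2) * sin t ^ (2 * Suc n)) has_integral ((2 * real n + 1) * (pi / 2 * W n)))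
      {0..pi / 2}"
    by (simp add: algebra_simps)
  from has_integral_mult_right[OF this, of "1 / (2 * real n + 2)"] show ?case
    by (simp add: W_Suc mult_ac)
qed

text \<open>Termwise integration of the binomial series; for fixed \<open>x < 1\<close> it converges uniformly in \<open>t\<close>,
being dominated by \<open>\<Sum> W\<^sub>n x\<^sup>n\<close>.\<close>

lemma ellK_sums_integral:
  assumes "0 \<le> x" "x < 1"
  shows "(\<lambda>n. pi / 2 * (W n)\<^sup>2 * x ^ n) sums integral {0..pi / 2} (\<lambda>t. 1 / sqrt (1 - x * (sin t)\<^sup>2))"
proof -
  have le: "x * (sin t)\<^sup>2 \<le> x" for t
    using assms mult_left_mono[of "(sin t)\<^sup>2" 1 x] by (simp add: abs_square_le_1)
  have "uniform_limit {0..pi / 2} (\<lambda>N t. \<Sum>n<N. W n * (x * (sin t)\<^sup>2) ^ n)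
      (\<lambda>t. \<Sum>n. W n * (x * (sin t)\<^sup>2) ^ n) sequentially"
  proof (rule Weierstrass_m_test)
    fix n and t :: real
    have "(x * (sin t)\<^sup>2) ^ n \<le> x ^ n"
      using assms le by (intro power_mono) auto
    then show "norm (W n * (x * (sin t)\<^sup>2) ^ n) \<le> W n * x ^ n"
      using W_pos[of n] assms by (simp add: abs_mult power_abs)
  next
    show "summable (\<lambda>n. W n * x ^ n)"
      using inverse_sqrt_sums[of x] assms by (simp add: sums_iff)
  qed
  moreover have "(\<Sum>n. W n * (x * (sin t)\<^sup>2) ^ n) = 1 / sqrt (1 - x * (sin t)\<^sup>2)" for t
    using le[of t] assms by (intro sums_unique[symmetric] inverse_sqrt_sums) auto
  ultimately have "uniform_limit {0..pi / 2} (\<lambda>N t. \<Sum>n<N. W n * (x * (sin t)\<^sup>2) ^ n)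
      (\<lambda>t. 1 / sqrt (1 - x * (sin t)\<^sup>2)) sequentially"
    by simp
  then obtain I J where IJ:
      "\<And>N. ((\<lambda>t. \<Sum>n<N. W n * (x * (sin t)\<^sup>2) ^ n) has_integral I N) {0..pi / 2}"
      "((\<lambda>t. 1 / sqrt (1 - x * (sin t)\<^sup>2)) has_integral J) {0..pi / 2}" "I \<longlonglongrightarrow> J"
    by (rule uniform_limit_integral) (auto intro!: continuous_intros)
  have "I = (\<lambda>N. \<Sum>n<N. pi / 2 * (W n)\<^sup>2 * x ^ n)"
  proof (rule ext, rule has_integral_unique[OF IJ(1)])
    fix N
    have "((\<lambda>t. \<Sum>n<N. (W n * x ^ n) * sin t ^ (2 * n)) has_integral
        (\<Sum>n<N. (W n * x ^ n) * (pi / 2 * W n))) {0..pi / 2}"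
      by (intro has_integral_sum has_integral_mult_right integral_sin_power_even) auto
    then show "((\<lambda>t. \<Sum>n<N. W n * (x * (sin t)\<^sup>2) ^ n) has_integral
        (\<Sum>n<N. pi / 2 * (W n)\<^sup>2 * x ^ n)) {0..pi / 2}"
      by (simp add: power_mult_distrib power_mult power2_eq_square mult_ac)
  qed
  with IJ(2,3) show ?thesis
    by (simp only: sums_def integral_unique)
qed

text \<open>What remains of \<open>K(r\<^sup>2)\<close> once its logarithmic singularity at \<open>r = 1\<close> is removed. The integrand
is \<open>(1 - r sin t) / sqrt (1 - r\<^sup>2 sin\<^sup>2 t)\<close>, written so that it stays continuous at \<open>r = 1\<close>,
\<open>t = \<pi>/2\<close>.\<close>

definition ellK_reg :: "real \<Rightarrow> real" where
  "ellK_reg r = integral {0..pi / 2} (\<lambda>t. sqrt ((1 - r * sin t) / (1 + r * sin t)))"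

text \<open>The numerator 1 is split as \<open>r sin t + (1 - r sin t)\<close>. The first part has the antiderivative
\<open>- arsinh (r cos t / sqrt (1 - r\<^sup>2))\<close>.\<close>

lemma ellK_split:
  assumes "0 \<le> r" "r < 1"
  shows "integral {0..pi / 2} (\<lambda>t. 1 / sqrt (1 - r\<^sup>2 * (sin t)\<^sup>2))
    = arsinh (r / sqrt (1 - r\<^sup>2)) + ellK_reg r"
proof -
  define q where "q = sqrt (1 - r\<^sup>2)"
  have r2: "r\<^sup>2 < 1" using assms by (simp add: power_less_one_iff)
  then have q: "q > 0" "q\<^sup>2 = 1 - r\<^sup>2" by (simp_all add: q_def)
  have s: "0 \<le> r * sin t" "r * sin t < 1" if "t \<in> {0..pi / 2}" for t
  proof -
    have "0 \<le> sin t" "sin t \<le> 1" using that by (auto intro: sin_ge_zero)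
    then show "0 \<le> r * sin t" "r * sin t < 1"
      using assms mult_left_mono[of "sin t" 1 r] by auto
  qed
  have "((\<lambda>t. r * sin t / sqrt (1 - r\<^sup>2 * (sin t)\<^sup>2)) has_integral
      (- arsinh (r / q * cos (pi / 2)) - (- arsinh (r / q * cos 0)))) {0..pi / 2}"
  proof (rule fundamental_theorem_of_calculus)
    fix t :: real
    have "(r / q * cos t)\<^sup>2 + 1 = (1 - r\<^sup>2 * (sin t)\<^sup>2) / q\<^sup>2"
      using q by (simp add: power_mult_distrib power_divide cos_squared_eq field_simps)
    then have "sqrt ((r / q * cos t)\<^sup>2 + 1) = sqrt (1 - r\<^sup>2 * (sin t)\<^sup>2) / q"
      using q(1) by (simp add: real_sqrt_divide)
    moreover have "((\<lambda>t. - arsinh (r / q * cos t)) has_real_derivative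
        - (1 / sqrt ((r / q * cos t)\<^sup>2 + 1) * (r / q * - sin t))) (at t within {0..pi / 2})"
      using q(1) by (intro DERIV_minus DERIV_chain2[OF arsinh_real_has_field_derivative])
        (auto intro!: derivative_eq_intros)
    ultimately show "((\<lambda>t. - arsinh (r / q * cos t)) has_vector_derivative
        r * sin t / sqrt (1 - r\<^sup>2 * (sin t)\<^sup>2)) (at t within {0..pi / 2})"
      using q by (simp add: has_real_derivative_iff_has_vector_derivative)
  qed simp
  then have "((\<lambda>t. r * sin t / sqrt (1 - r\<^sup>2 * (sin t)\<^sup>2)) has_integral arsinh (r / q)) {0..pi / 2}"
    by simp
  moreover have "((\<lambda>t. sqrt ((1 - r * sin t) / (1 + r * sin t))) has_integral ellK_reg r) {0..pi / 2}"
    unfolding ellK_reg_def using s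
    by (intro integrable_integral integrable_continuous_real continuous_intros) (force simp: add_nonneg_eq_0_iff)+
  ultimately have "((\<lambda>t. r * sin t / sqrt (1 - r\<^sup>2 * (sin t)\<^sup>2) + sqrt ((1 - r * sin t) / (1 + r * sin t)))
      has_integral (arsinh (r / q) + ellK_reg r)) {0..pi / 2}"
    by (rule has_integral_add)
  moreover have "r * sin t / sqrt (1 - r\<^sup>2 * (sin t)\<^sup>2) + sqrt ((1 - r * sin t) / (1 + r * sin t))
      = 1 / sqrt (1 - r\<^sup>2 * (sin t)\<^sup>2)" if "t \<in> {0..pi / 2}" for t
  proof -
    define y where "y = r * sin t"
    have y: "0 \<le> y" "y < 1" using s[OF that] by (simp_all add: y_def)
    have "1 - y\<^sup>2 = (1 - y) * (1 + y)" by (simp add: power2_eq_square algebra_simps)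
    then have "sqrt (1 - y\<^sup>2) = sqrt (1 - y) * sqrt (1 + y)" by (simp add: real_sqrt_mult)
    moreover have "sqrt (1 - y) * sqrt (1 - y) = 1 - y" using y by simp
    ultimately have "y / sqrt (1 - y\<^sup>2) + sqrt ((1 - y) / (1 + y)) = 1 / sqrt (1 - y\<^sup>2)"
      using y by (simp add: real_sqrt_divide field_simps)
    then show ?thesis by (simp add: y_def power_mult_distrib)
  qed
  ultimately have "((\<lambda>t. 1 / sqrt (1 - r\<^sup>2 * (sin t)\<^sup>2)) has_integral (arsinh (r / q) + ellK_reg r)) {0..pi / 2}"
    by (rule has_integral_eq[rotated]) auto
  then show ?thesis by (simp add: integral_unique q_def)
qed

lemma continuous_on_ellK_reg: "continuous_on {0..1} ellK_reg"
proof -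
  have "continuous_on ({0..1} \<times> cbox 0 (pi / 2)) (\<lambda>(r, t). sqrt ((1 - r * sin t) / (1 + r * sin t)))"
    unfolding case_prod_beta
  proof (intro continuous_intros ballI)
    fix p :: "real \<times> real" assume "p \<in> {0..1} \<times> cbox 0 (pi / 2)"
    then have "0 \<le> fst p * sin (snd p)" by (intro mult_nonneg_nonneg sin_ge_zero) auto
    then show "1 + fst p * sin (snd p) \<noteq> 0" by simp
  qed
  from integral_continuous_on_param[OF this] show ?thesis
    by (simp add: ellK_reg_def[abs_def])
qed

lemma ellK_reg_1: "ellK_reg 1 = ln 2"
proof -
  have "((\<lambda>t. cos t / (1 + sin t)) has_integral (ln (1 + sin (pi / 2)) - ln (1 + sin 0))) {0..pi / 2}"
  proof (rule fundamental_theorem_of_calculus)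
    fix t :: real assume "t \<in> {0..pi / 2}"
    then have "0 \<le> sin t" by (auto intro: sin_ge_zero)
    then show "((\<lambda>t. ln (1 + sin t)) has_vector_derivative cos t / (1 + sin t)) (at t within {0..pi / 2})"
      unfolding has_real_derivative_iff_has_vector_derivative[symmetric]
      by (auto intro!: derivative_eq_intros)
  qed simp
  moreover have "cos t / (1 + sin t) = sqrt ((1 - 1 * sin t) / (1 + 1 * sin t))" if "t \<in> {0..pi / 2}" for t
  proof -
    have "0 \<le> sin t" "0 \<le> cos t" using that by (auto intro: sin_ge_zero cos_ge_zero)
    moreover from this have "(1 - sin t) / (1 + sin t) = (cos t / (1 + sin t))\<^sup>2"
      by (simp add: power_divide cos_squared_eq power2_eq_square divide_simps) (simp add: algebra_simps)
    ultimately show ?thesis by simp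
  qed
  ultimately have "((\<lambda>t. sqrt ((1 - 1 * sin t) / (1 + 1 * sin t))) has_integral
      (ln (1 + sin (pi / 2)) - ln (1 + sin 0))) {0..pi / 2}"
    by (rule has_integral_eq[rotated])
  then have "((\<lambda>t. sqrt ((1 - 1 * sin t) / (1 + 1 * sin t))) has_integral ln 2) {0..pi / 2}"
    by simp
  then show ?thesis by (simp only: ellK_reg_def integral_unique)
qed

section \<open>The generating function as the exponential of the elliptic integral\<close>

lemma W_le_1: "W n \<le> 1"
proof (induction n)
  case (Suc n)
  have "W (Suc n) \<le> 1 * W n"
    unfolding W_Suc using W_pos[of n] by (intro mult_right_mono) auto
  with Suc.IH show ?case by simp
qed (simp add: W_0)

lemma sum_ellB_le_1: "(\<Sum>k\<le>n. ellB k) \<le> 1"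
proof -
  have "(\<Sum>k\<le>n. ellB k) \<le> suminf ellB"
    using ellB_sums_1 by (intro sum_le_suminf less_imp_le[OF ellB_pos] sums_summable[of _ 1]) auto
  then show ?thesis
    using sums_unique[OF ellB_sums_1] by simp
qed

text \<open>The recurrence makes \<open>(n + 1) b\<^bsub>n+1\<^esub>\<close> the sum of \<open>n b\<^sub>n\<close> and half a subconvex combination of
earlier terms, because the \<open>\<beta>\<^sub>k\<close> have total mass 1. The bound is there for the radius of
convergence.\<close>

lemma b_le_b_0: "b n \<le> b 0"
proof (induction n rule: less_induct)
  case (less n)
  show ?case
  proof (cases n)
    case (Suc m)
    have "(\<Sum>k\<le>m. ellB k * b (m - k)) \<le> (\<Sum>k\<le>m. ellB k * b 0)"
      using less.IH Suc by (intro sum_mono mult_left_mono less_imp_le[OF ellB_pos]) auto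
    also have "\<dots> \<le> 1 * b 0"
      unfolding sum_distrib_right[symmetric]
      using sum_ellB_le_1 b_pos[of 0] by (intro mult_right_mono) auto
    finally have "(\<Sum>k\<le>m. ellB k * b (m - k)) \<le> b 0" by simp
    moreover have "real m * b m \<le> real m * b 0"
      using less.IH[of m] Suc by (intro mult_left_mono) auto
    moreover have "b 0 > 0" by simp
    ultimately have "2 * (real m + 1) * b (Suc m) \<le> 2 * (real m + 1) * b 0"
      unfolding b_Suc by (simp add: algebra_simps del: b.simps)
    then show ?thesis
      by (simp add: Suc del: b.simps)
  qed simp
qed

lemma fps_conv_radius_bounded:
  fixes a :: "nat \<Rightarrow> real"
  assumes "\<And>n. \<bar>a n\<bar> \<le> M"
  shows "fps_conv_radius (Abs_fps a) \<ge> 1"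
  unfolding fps_conv_radius_def
proof (rule conv_radius_geI_ex')
  fix r :: real assume r: "0 < r" "ereal r < 1"
  show "summable (\<lambda>n. fps_nth (Abs_fps a) n * of_real r ^ n)"
  proof (rule summable_comparison_test')
    show "summable (\<lambda>n. M * r ^ n)"
      using r by (intro summable_mult summable_geometric) auto
    show "norm (fps_nth (Abs_fps a) n * of_real r ^ n) \<le> M * r ^ n" for n
      using assms[of n] r by (simp add: abs_mult mult_right_mono)
  qed
qed

text \<open>\<open>F\<close> and \<open>e\<^sup>K\<close> solve the same linear equation \<open>2 (1 - x) y' = B y\<close>, so \<open>F e\<^bsup>-K\<^esup>\<close> is constant, and
the initial value \<open>b\<^sub>0 = e\<^bsup>\<pi>/2\<^esup>\<close> makes the constant 1.\<close>

lemma eval_b_eq_exp_ellK: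
  fixes x :: real
  assumes "\<bar>x\<bar> < 1"
  shows "eval_fps (Abs_fps b) x = exp (eval_fps (Abs_fps (\<lambda>n. pi / 2 * (W n)\<^sup>2)) x)"
proof -
  let ?F = "Abs_fps b" and ?K = "Abs_fps (\<lambda>n. pi / 2 * (W n)\<^sup>2)" and ?C = "Abs_fps ellB"
  let ?X = "fps_X :: real fps"
  have ode_K: "2 * (1 - ?X) * fps_deriv ?K = ?C"
  proof (rule fps_ext)
    fix n
    show "fps_nth (2 * (1 - ?X) * fps_deriv ?K) n = fps_nth ?C n"
      by (cases n) (simp_all add: field_simps numeral_fps_const ellB_telescope)
  qed
  have rF: "fps_conv_radius ?F \<ge> 1"
    using b_pos b_le_b_0 by (intro fps_conv_radius_bounded[of _ "b 0"]) (simp add: less_imp_le abs_of_pos del: b.simps)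
  have rK: "fps_conv_radius ?K \<ge> 1"
    using W_pos W_le_1 by (intro fps_conv_radius_bounded[of _ "pi / 2"])
      (simp add: abs_mult power_le_one less_imp_le)
  have rF': "fps_conv_radius (fps_deriv ?F) \<ge> 1" and rK': "fps_conv_radius (fps_deriv ?K) \<ge> 1"
    using rF rK fps_conv_radius_deriv order_trans by blast+
  have r1: "fps_conv_radius (1 - ?X) \<ge> 1"
    using order_trans[OF min.boundedI fps_conv_radius_diff[of 1 ?X]] by simp
  have r2: "fps_conv_radius (2 * (1 - ?X)) \<ge> 1"
    using order_trans[OF min.boundedI[OF _ r1] fps_conv_radius_mult[of 2]] by simp
  have rC: "fps_conv_radius ?C \<ge> 1"
    using order_trans[OF min.boundedI[OF r2 rK'] fps_conv_radius_mult] unfolding ode_K .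
  have "\<exists>c. \<forall>y\<in>ball 0 1. eval_fps ?F y * exp (- eval_fps ?K y) = c"
  proof (rule has_field_derivative_zero_constant)
    fix y :: real assume "y \<in> ball 0 1"
    then have y: "ereal (norm y) < 1" "\<bar>y\<bar> < 1" by simp_all
    note lt = less_le_trans[OF y(1)]
    have mult: "eval_fps (f * g) y = eval_fps f y * eval_fps g y"
      if "fps_conv_radius f \<ge> 1" "fps_conv_radius g \<ge> 1" for f g :: "real fps"
      by (intro eval_fps_mult lt that)
    have "eval_fps (2 * (1 - ?X)) y = eval_fps 2 y * eval_fps (1 - ?X) y"
      by (rule mult) (simp_all add: r1)
    also have "eval_fps (1 - ?X) y = eval_fps 1 y - eval_fps ?X y"
      by (rule eval_fps_diff) simp_all
    finally have e2: "eval_fps (2 * (1 - ?X)) y = 2 * (1 - y)"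
      by simp
    have "2 * (1 - y) * eval_fps (fps_deriv ?F) y = eval_fps ?C y * eval_fps ?F y"
      using arg_cong[OF fps_ode_b, of "\<lambda>f. eval_fps f y"]
      by (simp only: mult[OF r2 rF'] mult[OF rC rF] e2)
    moreover have "2 * (1 - y) * eval_fps (fps_deriv ?K) y = eval_fps ?C y"
      using arg_cong[OF ode_K, of "\<lambda>f. eval_fps f y"]
      by (simp only: mult[OF r2 rK'] e2)
    ultimately have "2 * (1 - y) * eval_fps (fps_deriv ?F) y
        = 2 * (1 - y) * (eval_fps (fps_deriv ?K) y * eval_fps ?F y)"
      by (simp add: mult_ac)
    then have eq: "eval_fps (fps_deriv ?F) y = eval_fps (fps_deriv ?K) y * eval_fps ?F y"
      using y by (simp only: mult_cancel_left) auto
    have "((\<lambda>y. eval_fps ?F y * exp (- eval_fps ?K y)) has_real_derivative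
        eval_fps (fps_deriv ?F) y * exp (- eval_fps ?K y)
        + (exp (- eval_fps ?K y) * - eval_fps (fps_deriv ?K) y) * eval_fps ?F y) (at y within ball 0 1)"
      by (intro DERIV_mult DERIV_chain2[OF DERIV_exp] DERIV_minus has_field_derivative_eval_fps lt rF rK)
    then show "((\<lambda>y. eval_fps ?F y * exp (- eval_fps ?K y)) has_real_derivative 0) (at y within ball 0 1)"
      by (simp add: eq mult_ac)
  qed simp
  then obtain c where c: "\<And>y. \<bar>y\<bar> < 1 \<Longrightarrow> eval_fps ?F y * exp (- eval_fps ?K y) = c"
    by auto
  from c[of 0] have "c = 1"
    by (simp add: eval_fps_at_0 W_0 exp_minus)
  with c[OF assms] show ?thesis
    by (simp add: exp_minus field_simps)
qed

lemma b_sums_exp_ellK: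
  assumes "0 \<le> x" "x < 1"
  shows "(\<lambda>n. b n * x ^ n) sums exp (integral {0..pi / 2} (\<lambda>t. 1 / sqrt (1 - x * (sin t)\<^sup>2)))"
proof -
  have "fps_conv_radius (Abs_fps b) \<ge> 1"
    using b_pos b_le_b_0 by (intro fps_conv_radius_bounded[of _ "b 0"]) (simp add: less_imp_le abs_of_pos del: b.simps)
  moreover have "ereal (norm x) < 1"
    using assms by simp
  ultimately have "norm x < fps_conv_radius (Abs_fps b)"
    by (rule less_le_trans[rotated])
  then have "(\<lambda>n. b n * x ^ n) sums eval_fps (Abs_fps b) x"
    using sums_eval_fps[of x "Abs_fps b"] by simp
  moreover have "eval_fps (Abs_fps (\<lambda>n. pi / 2 * (W n)\<^sup>2)) x
      = integral {0..pi / 2} (\<lambda>t. 1 / sqrt (1 - x * (sin t)\<^sup>2))"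
    using ellK_sums_integral[OF assms] by (simp add: eval_fps_def sums_iff)
  ultimately show ?thesis
    using eval_b_eq_exp_ellK[of x] assms by simp
qed

section \<open>The limit of the quotients\<close>

text \<open>With \<open>q = sqrt (1 - x)\<close>, the factor \<open>exp (arsinh (sqrt x / q))\<close> is \<open>(1 + sqrt x) / q\<close>, so the
product with \<open>q\<close> tends to \<open>2 exp (ln 2)\<close>.\<close>

lemma radial_limit_b:
  "((\<lambda>x. sqrt (1 - x) * (\<Sum>n. b n * x ^ n)) \<longlongrightarrow> 4) (at_left 1)"
proof -
  have ev: "eventually (\<lambda>x. x \<in> {0<..<1::real}) (at_left 1)"
    by (rule eventually_at_left_real) simp
  have "((\<lambda>x. ellK_reg (sqrt x)) \<longlongrightarrow> ellK_reg (sqrt 1)) (at 1 within {0..1})"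
  proof -
    have "continuous_on {0..1} (\<lambda>x. ellK_reg (sqrt x))"
      by (intro continuous_on_compose2[OF continuous_on_ellK_reg] continuous_intros) auto
    then have "((\<lambda>x. ellK_reg (sqrt x)) \<longlongrightarrow> ellK_reg (sqrt x)) (at x within {0..1})"
      if "x \<in> {0..1}" for x
      using that unfolding continuous_on_def by blast
    from this[of 1] show ?thesis by simp
  qed
  then have "((\<lambda>x. ellK_reg (sqrt x)) \<longlongrightarrow> ln 2) (at_left 1)"
    by (simp add: ellK_reg_1 at_within_Icc_at_left)
  then have "((\<lambda>x. (1 + sqrt x) * exp (ellK_reg (sqrt x))) \<longlongrightarrow> (1 + sqrt 1) * exp (ln 2)) (at_left 1)"
    by (intro tendsto_intros)
  moreover have "eventually (\<lambda>x. (1 + sqrt x) * exp (ellK_reg (sqrt x))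
      = sqrt (1 - x) * (\<Sum>n. b n * x ^ n)) (at_left 1)"
    using ev
  proof eventually_elim
    case (elim x)
    define q where "q = sqrt (1 - x)"
    have q: "q > 0" "q\<^sup>2 = 1 - x" using elim by (simp_all add: q_def)
    have "sqrt ((sqrt x / q)\<^sup>2 + 1) = 1 / q"
    proof (rule real_sqrt_unique)
      show "(1 / q)\<^sup>2 = (sqrt x / q)\<^sup>2 + 1"
        using q elim by (simp add: power_divide field_simps)
    qed (use q in simp)
    then have "exp (arsinh (sqrt x / q)) = (1 + sqrt x) / q"
      using q elim by (simp add: arsinh_real_def add_pos_pos add_divide_distrib)
    moreover have "(\<Sum>n. b n * x ^ n) = exp (arsinh (sqrt x / q) + ellK_reg (sqrt x))"
      using sums_unique[OF b_sums_exp_ellK[of x]] ellK_split[of "sqrt x"] elim by (simp add: q_def)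
    ultimately show ?case
      using q(1) by (simp add: exp_add flip: q_def)
  qed
  ultimately show ?thesis
    by (auto elim: Lim_transform_eventually)
qed

text \<open>Finitely many coefficients of arbitrary sign form a polynomial, whose contribution is killed by
the factor \<open>sqrt (1 - x)\<close>. Applied to \<open>b - v W\<close> and to \<open>v W - b\<close>, this turns bounds on
\<open>b\<^sub>n / W\<^sub>n\<close> that hold for large \<open>n\<close> into bounds on the radial limit.\<close>

lemma radial_limit_nonneg:
  fixes a :: "nat \<Rightarrow> real"
  assumes nonneg: "\<And>n. n \<ge> N \<Longrightarrow> a n \<ge> 0"
    and summable: "\<And>x. 0 < x \<Longrightarrow> x < 1 \<Longrightarrow> summable (\<lambda>n. a n * x ^ n)"
    and lim: "((\<lambda>x. sqrt (1 - x) * (\<Sum>n. a n * x ^ n)) \<longlongrightarrow> l) (at_left 1)"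
  shows "l \<ge> 0"
proof (rule tendsto_le[OF _ lim])
  have "((\<lambda>x. sqrt (1 - x) * (\<Sum>n<N. a n * x ^ n)) \<longlongrightarrow> sqrt (1 - 1) * (\<Sum>n<N. a n * 1 ^ n)) (at_left 1)"
    by (intro tendsto_intros)
  then show "((\<lambda>x. sqrt (1 - x) * (\<Sum>n<N. a n * x ^ n)) \<longlongrightarrow> 0) (at_left 1)"
    by simp
  have "eventually (\<lambda>x. x \<in> {0<..<1::real}) (at_left 1)"
    by (rule eventually_at_left_real) simp
  then show "eventually (\<lambda>x. sqrt (1 - x) * (\<Sum>n<N. a n * x ^ n) \<le> sqrt (1 - x) * (\<Sum>n. a n * x ^ n)) (at_left 1)"
  proof eventually_elim
    case (elim x)
    then show ?case
      by (intro mult_left_mono sum_le_suminf summable) (auto intro!: mult_nonneg_nonneg nonneg)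
  qed
qed simp

lemma radial_limit_b_minus_W:
  "((\<lambda>x. sqrt (1 - x) * (\<Sum>n. (b n - v * W n) * x ^ n)) \<longlongrightarrow> 4 - v) (at_left 1)"
    (is ?lim)
  and summable_b_minus_W: "0 < x \<Longrightarrow> x < 1 \<Longrightarrow> summable (\<lambda>n. (b n - v * W n) * x ^ n)"
proof -
  have sums: "(\<lambda>n. (b n - v * W n) * x ^ n) sums ((\<Sum>n. b n * x ^ n) - v * (1 / sqrt (1 - x)))"
    if "0 < x" "x < 1" for x
  proof -
    have "(\<lambda>n. b n * x ^ n) sums (\<Sum>n. b n * x ^ n)"
      using b_sums_exp_ellK[of x] that by (simp add: sums_iff)
    moreover have "(\<lambda>n. W n * x ^ n) sums (1 / sqrt (1 - x))"
      using that by (intro inverse_sqrt_sums) auto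
    ultimately have "(\<lambda>n. b n * x ^ n - v * (W n * x ^ n)) sums ((\<Sum>n. b n * x ^ n) - v * (1 / sqrt (1 - x)))"
      by (intro sums_diff sums_mult)
    then show ?thesis by (simp add: left_diff_distrib mult.assoc)
  qed
  show "summable (\<lambda>n. (b n - v * W n) * x ^ n)" if "0 < x" "x < 1"
    using sums[OF that] by (simp add: sums_iff)
  have "eventually (\<lambda>x. x \<in> {0<..<1::real}) (at_left 1)"
    by (rule eventually_at_left_real) simp
  then have "eventually (\<lambda>x. sqrt (1 - x) * (\<Sum>n. b n * x ^ n) - v
      = sqrt (1 - x) * (\<Sum>n. (b n - v * W n) * x ^ n)) (at_left 1)"
  proof eventually_elim
    case (elim x)
    then show ?case
      using sums_unique[OF sums[of x], symmetric] by (simp add: right_diff_distrib)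
  qed
  with tendsto_diff[OF radial_limit_b tendsto_const[of v]] show ?lim
    by (rule Lim_transform_eventually)
qed

text \<open>For the limit, the comparison is made twice. From index \<open>N\<close> on, \<open>b\<^sub>n \<ge> u\<^sub>N W\<^sub>n\<close> with
\<open>u\<^sub>n = b\<^sub>n / W\<^sub>n\<close>, which gives \<open>u\<^sub>N \<le> 4\<close>; so \<open>u\<close> converges to some \<open>L \<le> 4\<close>. From index 1 on,
\<open>b\<^sub>n \<le> L W\<^sub>n\<close>, which gives \<open>4 \<le> L\<close>.\<close>

theorem lemma3:
  shows "strict_mono_on {1..} (\<lambda>n. b n / W n) \<and> (\<lambda>n. b n / W n) \<longlonglongrightarrow> 4"
proof
  show mono: "strict_mono_on {1..} (\<lambda>n. b n / W n)"
    by (rule b_W_ratio_strict_mono)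
  define u where "u n = b n / W n" for n
  have b_u: "b n = u n * W n" for n
    using W_pos[of n] by (simp add: u_def)
  have u_mono: "u m \<le> u n" if "1 \<le> m" "m \<le> n" for m n
    using strict_mono_onD[OF mono, of m n] that by (cases "m = n") (auto simp: u_def less_imp_le)
  have le_4: "u (Suc N) \<le> 4" for N
  proof -
    have "b n - u (Suc N) * W n \<ge> 0" if "n \<ge> Suc N" for n
      using u_mono[of "Suc N" n] W_pos[of n] that by (simp add: b_u)
    then have "0 \<le> 4 - u (Suc N)"
      by (rule radial_limit_nonneg[OF _ summable_b_minus_W radial_limit_b_minus_W])
    then show ?thesis by simp
  qed
  have inc: "incseq (\<lambda>n. u (Suc n))"
    by (intro incseq_SucI u_mono) auto
  obtain L where L: "(\<lambda>n. u (Suc n)) \<longlonglongrightarrow> L" "\<And>n. u (Suc n) \<le> L"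
    using incseq_convergent[OF inc, of 4] le_4 by auto
  have "L \<le> 4"
    using L(1) le_4 by (intro LIMSEQ_le_const2) auto
  moreover have "4 \<le> L"
  proof -
    have "0 \<le> - (b n - L * W n)" if "n \<ge> 1" for n
      using L(2)[of "n - 1"] W_pos[of n] that by (simp add: b_u)
    moreover have "summable (\<lambda>n. - (b n - L * W n) * x ^ n)" if "0 < x" "x < 1" for x
      using summable_minus[OF summable_b_minus_W[OF that, of L]] by (simp only: mult_minus_left)
    moreover have "((\<lambda>x. sqrt (1 - x) * (\<Sum>n. - (b n - L * W n) * x ^ n)) \<longlongrightarrow> - (4 - L)) (at_left 1)"
    proof (rule Lim_transform_eventually[OF tendsto_minus[OF radial_limit_b_minus_W]])
      have "eventually (\<lambda>x. x \<in> {0<..<1::real}) (at_left 1)"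
        by (rule eventually_at_left_real) simp
      then show "eventually (\<lambda>x. - (sqrt (1 - x) * (\<Sum>n. (b n - L * W n) * x ^ n))
          = sqrt (1 - x) * (\<Sum>n. - (b n - L * W n) * x ^ n)) (at_left 1)"
        by eventually_elim (simp only: mult_minus_left suminf_minus summable_b_minus_W mult_minus_right greaterThanLessThan_iff)
    qed
    ultimately have "0 \<le> - (4 - L)"
      by (rule radial_limit_nonneg)
    then show ?thesis by simp
  qed
  ultimately have "(\<lambda>n. u (Suc n)) \<longlonglongrightarrow> 4"
    using L(1) by simp
  then show "(\<lambda>n. b n / W n) \<longlonglongrightarrow> 4"
    unfolding u_def by (rule LIMSEQ_imp_Suc)
qed

end
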